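(* Let $n\ge 4$ be an integer, and let $d_2(n,4)$ be the largest $d$ such that there is a binary LCD $[n,4,d]$ code. Then $$d_2(n,4)=\begin{cases}\left\lfloor \frac{8n}{15}\right\rfloor & \text{if } n\equiv 5,9,13 \pmod{15},\\[2pt] \left\lfloor \frac{8n}{15}\right\rfloor-1 & \text{if } n\equiv 1,2,3,4,6,7,8,10,11,12,14 \pmod{15},\\[2pt] \left\lfloor \frac{8n}{15}\right\rfloor-2 & \text{if } n\equiv 0 \pmod{15}.\end{cases}$$
   Context: A binary $[n,k,d]$ code is a $k$-dimensional subspace $C$ of $\mathbb{F}_2^n$ whose minimum weight (the smallest Hamming weight of a nonzero codeword) is exactly $d$. With $C^\perp=\{x\in\mathbb{F}_2^n: x\cdot y=0 \text{ for all } y\in C\}$ for the standard inner product, $C$ is LCD (linear complementary dual) if $C\cap C^\perp=\{0\}$. *)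

theory Defs
  imports Complex_Main "HOL-Library.Z2" "HOL-Library.Function_Algebras"
begin

definition scale_vec :: "bit \<Rightarrow> (nat \<Rightarrow> bit) \<Rightarrow> nat \<Rightarrow> bit"
  where "scale_vec c x = (\<lambda>i. c * x i)"

global_interpretation F2: vector_space scale_vec
  by unfold_locales (auto simp: scale_vec_def algebra_simps fun_eq_iff)

(* The space F_2^n, with coordinates indexed by 0, ..., n - 1: a vector is padded with zeros,
   so that F_2^n is a finite subspace of "nat \<Rightarrow> bit" for every n. *)
definition F2_space :: "nat \<Rightarrow> (nat \<Rightarrow> bit) set"
  where "F2_space n = {x. \<forall>i\<ge>n. x i = 0}"

definition inner_F2 :: "nat \<Rightarrow> (nat \<Rightarrow> bit) \<Rightarrow> (nat \<Rightarrow> bit) \<Rightarrow> bit"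
  where "inner_F2 n x y = (\<Sum>i<n. x i * y i)"

definition hamming_weight :: "nat \<Rightarrow> (nat \<Rightarrow> bit) \<Rightarrow> nat"
  where "hamming_weight n x = card {i. i < n \<and> x i \<noteq> 0}"

definition has_min_weight :: "nat \<Rightarrow> (nat \<Rightarrow> bit) set \<Rightarrow> nat \<Rightarrow> bool"
  where "has_min_weight n C d \<longleftrightarrow>
    (\<exists>x\<in>C - {0}. hamming_weight n x = d) \<and> (\<forall>x\<in>C - {0}. d \<le> hamming_weight n x)"

definition binary_code :: "nat \<Rightarrow> nat \<Rightarrow> nat \<Rightarrow> (nat \<Rightarrow> bit) set \<Rightarrow> bool"
  where "binary_code n k d C \<longleftrightarrow>
    F2.subspace C \<and> C \<subseteq> F2_space n \<and> F2.dim C = k \<and> has_min_weight n C d"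

definition dual_code :: "nat \<Rightarrow> (nat \<Rightarrow> bit) set \<Rightarrow> (nat \<Rightarrow> bit) set"
  where "dual_code n C = {x \<in> F2_space n. \<forall>y\<in>C. inner_F2 n x y = 0}"

definition LCD :: "nat \<Rightarrow> (nat \<Rightarrow> bit) set \<Rightarrow> bool"
  where "LCD n C \<longleftrightarrow> C \<inter> dual_code n C = {0}"

(* The set is bounded by n; d2 n k is meaningful when it is nonempty, i.e. when some binary
   LCD code of length n and dimension k \<ge> 1 exists. *)
definition d2 :: "nat \<Rightarrow> nat \<Rightarrow> nat"
  where "d2 n k = Max {d. \<exists>C. binary_code n k d C \<and> LCD n C}"

end

theory Submission
  imports Defs "HOL-Library.Product_Plus"
begin

text \<open>The largest minimum weight of a binary LCD code of dimension 4 comes from a bound that refines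
the Plotkin bound by weights modulo 4, and from a family of codes that meets it.

Upper bound. For words \<open>x\<close>, \<open>y\<close> of a code \<open>C\<close> one has
\<open>wt (x + y) = wt x + wt y - 2 wt (x * y)\<close>, so \<open>x \<mapsto> \<i> ^ wt x\<close> is a quadratic character whose
polar form is the inner product. If \<open>C\<close> is LCD, that form is nondegenerate on \<open>C\<close>, and the
Gauss sum \<open>G\<close> of \<open>\<i> ^ wt x\<close> over \<open>C\<close> satisfies \<open>\<bar>G\<bar>\<^sup>2 = \<bar>C\<bar>\<close> (\<open>gauss_sum_norm\<close>). In
dimension 4 this is 16, so \<open>G\<close> is 4 times a power of \<open>\<i>\<close>. Together with the fact that none or half
of the words have odd weight, this leaves only six possibilities for the numbers of words in the
residue classes of the weight modulo 4 (\<open>weight_distribution_LCD_dim_4\<close>). Each of them forces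
many nonzero words to have a weight different from \<open>d\<close> modulo 4, hence larger than \<open>d\<close>. As the
weights of all words add up to at most \<open>8 * n\<close>, this gives \<open>15 * d + \<delta> \<le> 8 * n\<close> with
\<open>\<delta> = 12, 17, 10, 19\<close> for \<open>d \<equiv> 0, 1, 2, 3\<close> modulo 4 (\<open>LCD_dim_4_bound\<close>).

Lower bound. Adding to a generator matrix the 15 columns of the simplex code adds 8 to all
nonzero weights and does not change the Gram matrix, on which the LCD property depends. So it is enough
to have codes of minimum weight at least 1, ..., 8 of suitable lengths up to 17, and to fill up with
zero coordinates (\<open>LCD_dim_4_exists\<close>). For every \<open>n\<close> the two bounds agree.\<close>

(* The default simplification rules rewrite + and * on bits to Boolean connectives, which hides the
   additive structure that all proofs use. *)
declare add_bit_eq_xor [simp del] mult_bit_eq_and [simp del]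

section \<open>Additive characters on binary codes\<close>

definition sgn_F2 :: "bit \<Rightarrow> int"
  where "sgn_F2 b = (if b = 0 then 1 else - 1)"

lemma sgn_F2_0 [simp]: "sgn_F2 0 = 1" and sgn_F2_1 [simp]: "sgn_F2 1 = - 1"
  by (auto simp: sgn_F2_def)

lemma sgn_F2_add: "sgn_F2 (a + b) = sgn_F2 a * sgn_F2 b"
  by (cases a; cases b) (auto simp: sgn_F2_def)

lemma scale_vec_simps [simp]: "scale_vec 0 x = 0" "scale_vec 1 x = x"
  by (auto simp: scale_vec_def fun_eq_iff)

lemma add_self_F2 [simp]: "x + x = (0 :: nat \<Rightarrow> bit)"
  by (auto simp: fun_eq_iff)

lemma subspace_F2_iff:
  "F2.subspace C \<longleftrightarrow> 0 \<in> C \<and> (\<forall>x\<in>C. \<forall>y\<in>C. x + y \<in> C)"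
proof -
  have "scale_vec c x \<in> C" if "0 \<in> C" "x \<in> C" for c x
    using that by (cases c) auto
  then show ?thesis
    by (auto simp: F2.subspace_def)
qed

lemma sum_subspace_translate:
  assumes "F2.subspace C" "z \<in> C"
  shows "(\<Sum>x\<in>C. f (x + z)) = (\<Sum>x\<in>C. f x)"
  by (rule sum.reindex_bij_witness[where i = "\<lambda>x. x + z" and j = "\<lambda>x. x + z"])
     (use assms in \<open>auto simp: subspace_F2_iff add.assoc\<close>)

text \<open>Orthogonality of characters: translation by \<open>z\<close> permutes the code and flips every sign.\<close>
lemma character_sum_eq_0:
  assumes "F2.subspace C" "z \<in> C" "f z = 1"
    and add: "\<And>x y. x \<in> C \<Longrightarrow> y \<in> C \<Longrightarrow> f (x + y) = f x + f y"
  shows "(\<Sum>x\<in>C. sgn_F2 (f x)) = 0"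
proof -
  have "(\<Sum>x\<in>C. sgn_F2 (f x)) = (\<Sum>x\<in>C. sgn_F2 (f (x + z)))"
    using sum_subspace_translate[OF assms(1,2), of "\<lambda>x. sgn_F2 (f x)"] by simp
  also have "\<dots> = (\<Sum>x\<in>C. - sgn_F2 (f x))"
    by (intro sum.cong) (auto simp: add assms(2,3) sgn_F2_add)
  finally show ?thesis
    by (simp add: sum_negf)
qed

lemma character_sum_card:
  assumes "finite C"
  shows "(\<Sum>x\<in>C. sgn_F2 (f x)) = int (card C) - 2 * int (card {x\<in>C. f x = 1})"
proof -
  have "(\<Sum>x\<in>C. sgn_F2 (f x)) = (\<Sum>x\<in>C. 1 - 2 * (if f x = 1 then 1 else 0))"
    by (intro sum.cong) (auto simp: sgn_F2_def)
  also have "\<dots> = int (card C) - 2 * (\<Sum>x\<in>C. if f x = 1 then 1 else 0)"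
    by (simp add: sum_subtractf sum_distrib_left)
  also have "(\<Sum>x\<in>C. if f x = 1 then 1 else 0) = int (card {x\<in>C. f x = 1})"
    by (simp add: sum.If_cases assms Int_def conj_commute)
  finally show ?thesis .
qed

text \<open>Used twice: for the coordinate functions, which bounds the total weight of a code, and for
the parity of the weight, which shows that the odd words make up none or half of a code.\<close>
lemma card_fibre_additive:
  fixes f :: "(nat \<Rightarrow> bit) \<Rightarrow> bit"
  assumes C: "F2.subspace C" "finite C"
    and add: "\<And>x y. x \<in> C \<Longrightarrow> y \<in> C \<Longrightarrow> f (x + y) = f x + f y"
  shows "card {x\<in>C. f x = 1} = 0 \<or> 2 * card {x\<in>C. f x = 1} = card C"
proof (cases "\<exists>z\<in>C. f z = 1")
  case True
  then obtain z where "z \<in> C" "f z = 1" by blast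
  then show ?thesis
    using character_sum_eq_0[OF C(1), of z f] add character_sum_card[OF C(2), of f] by simp
next
  case False
  then have "{x\<in>C. f x = 1} = {}" by blast
  then show ?thesis by (metis card.empty)
qed

lemma finite_F2_space: "finite (F2_space n)"
proof -
  have "F2_space n \<subseteq> (\<lambda>S i. if i \<in> S then 1 else 0) ` Pow {..<n}"
  proof
    fix x assume "x \<in> F2_space n"
    then have "x = (\<lambda>i. if i \<in> {i. i < n \<and> x i = 1} then 1 else 0)"
      by (auto simp: F2_space_def fun_eq_iff not_less)
    then show "x \<in> (\<lambda>S i. if i \<in> S then 1 else 0) ` Pow {..<n}"
      by (rule image_eqI) auto
  qed
  then show ?thesis
    by (rule finite_subset) simp
qed

text \<open>Adjoining an independent vector \<open>b\<close> doubles a span: scalars are 0 and 1, so the new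
span is the disjoint union of the old one and its translate by \<open>b\<close>.\<close>
lemma card_span_independent:
  assumes "finite B" "F2.independent B"
  shows "finite (F2.span B) \<and> card (F2.span B) = 2 ^ card B"
  using assms
proof (induction B)
  case (insert b B)
  then have b: "b \<notin> F2.span B" and IH: "finite (F2.span B)" "card (F2.span B) = 2 ^ card B"
    by (auto simp: F2.independent_insert)
  have "F2.span (insert b B) = {x. \<exists>k. x - scale_vec k b \<in> F2.span B}"
    by (rule F2.span_insert)
  also have "\<dots> = F2.span B \<union> (+) b ` F2.span B"
  proof (intro equalityI subsetI)
    fix x assume "x \<in> {x. \<exists>k. x - scale_vec k b \<in> F2.span B}"
    then obtain k where k: "x - scale_vec k b \<in> F2.span B"
      by blast
    show "x \<in> F2.span B \<union> (+) b ` F2.span B"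
    proof (cases "k = 0")
      case True
      then show ?thesis using k by simp
    next
      case False
      then have "x - b \<in> F2.span B" "x = b + (x - b)"
        using k by simp_all
      then show ?thesis by blast
    qed
  next
    fix x assume "x \<in> F2.span B \<union> (+) b ` F2.span B"
    then have "x - scale_vec 0 b \<in> F2.span B \<or> x - scale_vec 1 b \<in> F2.span B"
      by auto
    then show "x \<in> {x. \<exists>k. x - scale_vec k b \<in> F2.span B}"
      by blast
  qed
  finally have "F2.span (insert b B) = F2.span B \<union> (+) b ` F2.span B" .
  moreover have "F2.span B \<inter> (+) b ` F2.span B = {}"
  proof -
    have "b \<in> F2.span B" if "y \<in> F2.span B" "b + y \<in> F2.span B" for y
      using F2.span_diff[OF that(2,1)] by simp
    then show ?thesis
      using b by auto
  qed
  ultimately show ?case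
    using insert IH by (simp add: card_Un_disjoint card_image)
qed auto

lemma card_subspace_F2:
  assumes "F2.subspace C" "finite C"
  shows "card C = 2 ^ F2.dim C"
proof -
  obtain B where B: "B \<subseteq> C" "F2.independent B" "C \<subseteq> F2.span B" "card B = F2.dim C"
    using F2.basis_exists by blast
  then have "F2.span B = C"
    using assms(1) F2.span_minimal by blast
  then show ?thesis
    using card_span_independent[of B] B assms(2) finite_subset by metis
qed

section \<open>Hamming weights and the inner product\<close>

lemma hamming_weight_eq_sum: "hamming_weight n x = (\<Sum>i<n. if x i = 1 then 1 else 0)"
proof -
  have "{i. i < n \<and> x i \<noteq> 0} = {..<n} \<inter> {i. x i = 1}"
    by auto
  then show ?thesis
    by (simp add: hamming_weight_def sum.If_cases)
qed

text \<open>Double counting: each of the \<open>n\<close> coordinates is 1 on at most half of the code. Comparing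
this with \<open>d\<close> for each nonzero word gives the Plotkin bound.\<close>
lemma sum_hamming_weight_le:
  assumes "F2.subspace C" "finite C"
  shows "2 * (\<Sum>x\<in>C. hamming_weight n x) \<le> n * card C"
proof -
  have "(\<Sum>x\<in>C. hamming_weight n x) = (\<Sum>i<n. \<Sum>x\<in>C. if x i = 1 then 1 else 0)"
    unfolding hamming_weight_eq_sum by (rule sum.swap)
  also have "\<dots> = (\<Sum>i<n. card {x\<in>C. x i = 1})"
    by (simp add: sum.If_cases assms Int_def)
  finally have "2 * (\<Sum>x\<in>C. hamming_weight n x) = (\<Sum>i<n. 2 * card {x\<in>C. x i = 1})"
    by (simp add: sum_distrib_left)
  also have "\<dots> \<le> (\<Sum>i<n. card C)"
  proof (rule sum_mono)
    fix i
    show "2 * card {x\<in>C. x i = 1} \<le> card C"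
      using card_fibre_additive[OF assms, of "\<lambda>x. x i"] by auto
  qed
  finally show ?thesis by simp
qed

lemma inner_F2_add_left: "inner_F2 n (x + y) z = inner_F2 n x z + inner_F2 n y z"
  by (simp add: inner_F2_def algebra_simps sum.distrib)

lemma inner_F2_commute: "inner_F2 n x y = inner_F2 n y x"
  by (simp add: inner_F2_def mult.commute)

lemma sgn_F2_inner: "of_int (sgn_F2 (inner_F2 n x y)) = (\<i> :: complex) ^ (2 * hamming_weight n (x * y))"
proof -
  have "of_int (sgn_F2 (inner_F2 n x y)) = (- 1 :: complex) ^ hamming_weight n (x * y)"
    unfolding inner_F2_def hamming_weight_eq_sum
    by (induction n) (auto simp: sgn_F2_add)
  then show ?thesis
    by (simp add: power_mult)
qed

text \<open>The pointwise product \<open>x * y\<close> is the indicator vector of the common support; the parity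
of its weight is the inner product of \<open>x\<close> and \<open>y\<close>.\<close>
lemma hamming_weight_add:
  "hamming_weight n (x + y) + 2 * hamming_weight n (x * y) = hamming_weight n x + hamming_weight n y"
proof -
  have "(if (x + y) i = 1 then 1 else 0) + 2 * (if (x * y) i = 1 then 1 else 0) =
      (if x i = 1 then 1 else 0) + (if y i = 1 then 1 else (0 :: nat))" for i
    by (cases "x i"; cases "y i") auto
  then show ?thesis
    unfolding hamming_weight_eq_sum by (simp add: sum_distrib_left flip: sum.distrib)
qed

text \<open>So modulo 4 the weight is a quadratic function on the code, with the inner product as its
polar form.\<close>
lemma power_i_hamming_weight_add:
  "\<i> ^ hamming_weight n (x + y) =
    \<i> ^ hamming_weight n x * \<i> ^ hamming_weight n y * of_int (sgn_F2 (inner_F2 n x y))"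
proof -
  have sq: "of_int (sgn_F2 b) * of_int (sgn_F2 b) = (1 :: complex)" for b
    by (simp add: sgn_F2_def)
  have "\<i> ^ hamming_weight n x * \<i> ^ hamming_weight n y =
      \<i> ^ hamming_weight n (x + y) * of_int (sgn_F2 (inner_F2 n x y))"
    unfolding sgn_F2_inner by (simp only: hamming_weight_add flip: power_add)
  then show ?thesis
    by (simp add: sq mult.assoc)
qed

section \<open>The Gauss sum of an LCD code\<close>

text \<open>In \<open>G * cnj G\<close>, substitute \<open>x = z + y\<close> in the pair \<open>(x, y)\<close>. The terms that belong to
a fixed \<open>z\<close> add up to a multiple of the character sum of \<open>y \<mapsto> y \<cdot> z\<close> over the code. As
the code meets its dual only in 0, this sum vanishes for \<open>z \<noteq> 0\<close>, and \<open>z = 0\<close>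
contributes the cardinality of the code.\<close>
lemma gauss_sum_norm:
  assumes C: "F2.subspace C" "C \<subseteq> F2_space n" and "LCD n C"
  defines "G \<equiv> \<Sum>x\<in>C. \<i> ^ hamming_weight n x"
  shows "G * cnj G = of_nat (card C)"
proof -
  have fin: "finite C"
    using C(2) finite_F2_space finite_subset by blast
  have zero: "0 \<in> C"
    using C(1) F2.subspace_0 by blast
  let ?w = "\<lambda>x. \<i> ^ hamming_weight n x"
  have unit: "?w y * cnj (?w y) = 1" for y
    by (simp flip: power_mult_distrib)
  have "G * cnj G = (\<Sum>y\<in>C. (\<Sum>x\<in>C. ?w x) * cnj (?w y))"
    by (simp add: G_def sum_distrib_left)
  also have "\<dots> = (\<Sum>y\<in>C. (\<Sum>z\<in>C. ?w (z + y)) * cnj (?w y))"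
    by (intro sum.cong refl) (simp add: sum_subspace_translate[OF C(1), where f = ?w])
  also have "\<dots> = (\<Sum>y\<in>C. \<Sum>z\<in>C. ?w z * of_int (sgn_F2 (inner_F2 n y z)))"
    unfolding sum_distrib_right
  proof (intro sum.cong refl)
    fix y z
    have "?w (z + y) * cnj (?w y) = ?w z * of_int (sgn_F2 (inner_F2 n y z)) * (?w y * cnj (?w y))"
      by (simp add: power_i_hamming_weight_add inner_F2_commute)
    then show "?w (z + y) * cnj (?w y) = ?w z * of_int (sgn_F2 (inner_F2 n y z))"
      unfolding unit by simp
  qed
  also have "\<dots> = (\<Sum>z\<in>C. ?w z * of_int (\<Sum>y\<in>C. sgn_F2 (inner_F2 n y z)))"
    by (subst sum.swap) (simp add: sum_distrib_left)
  also have "\<dots> = (\<Sum>z\<in>C. if z = 0 then of_nat (card C) else 0)"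
  proof (intro sum.cong refl)
    fix z assume z: "z \<in> C"
    show "?w z * of_int (\<Sum>y\<in>C. sgn_F2 (inner_F2 n y z)) = (if z = 0 then of_nat (card C) else 0)"
    proof (cases "z = 0")
      case True
      then show ?thesis by (simp add: inner_F2_def hamming_weight_def)
    next
      case False
      then have "z \<notin> dual_code n C"
        using \<open>LCD n C\<close> z by (auto simp: LCD_def)
      then obtain y where "y \<in> C" "inner_F2 n y z = 1"
        using z C(2) by (auto simp: dual_code_def inner_F2_commute)
      then have "(\<Sum>y\<in>C. sgn_F2 (inner_F2 n y z)) = 0"
        by (intro character_sum_eq_0[OF C(1)]) (auto simp: inner_F2_add_left)
      then show ?thesis using False by simp
    qed
  qed
  also have "\<dots> = of_nat (card C)"
    using fin zero by simp
  finally show ?thesis .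
qed

section \<open>Weights modulo 4 in dimension 4\<close>

definition weight_class :: "nat \<Rightarrow> (nat \<Rightarrow> bit) set \<Rightarrow> nat \<Rightarrow> nat"
  where "weight_class n C j = card {x\<in>C. hamming_weight n x mod 4 = j}"

lemma sum_by_weight_class:
  fixes g :: "nat \<Rightarrow> 'a :: comm_semiring_1"
  assumes "finite C"
  shows "(\<Sum>x\<in>C. g (hamming_weight n x mod 4)) =
    of_nat (weight_class n C 0) * g 0 + of_nat (weight_class n C 1) * g 1 +
    of_nat (weight_class n C 2) * g 2 + of_nat (weight_class n C 3) * g 3"
proof -
  have "(\<Sum>x\<in>C. g (hamming_weight n x mod 4)) =
      (\<Sum>j<4. \<Sum>x\<in>{x\<in>C. hamming_weight n x mod 4 = j}. g (hamming_weight n x mod 4))"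
    using assms by (intro sum.group[symmetric]) auto
  also have "\<dots> = (\<Sum>j<4. of_nat (weight_class n C j) * g j)"
    by (simp add: weight_class_def)
  also have "{..<4} = {0, 1, 2, 3 :: nat}"
    by auto
  finally show ?thesis
    by (simp add: add.assoc)
qed

text \<open>The real and imaginary parts of the Gauss sum, in terms of the numbers of words in the
residue classes.\<close>
lemma weight_class_LCD:
  assumes C: "F2.subspace C" "C \<subseteq> F2_space n" and "LCD n C"
  defines "c \<equiv> \<lambda>j. int (weight_class n C j)"
  shows "(c 0 - c 2)\<^sup>2 + (c 1 - c 3)\<^sup>2 = int (card C)"
proof -
  have fin: "finite C"
    using C(2) finite_F2_space finite_subset by blast
  let ?G = "\<Sum>x\<in>C. \<i> ^ hamming_weight n x"
  have "\<i> ^ m = \<i> ^ (m mod 4)" for m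
  proof -
    have "\<i> ^ m = \<i> ^ (4 * (m div 4) + m mod 4)" by simp
    also have "\<dots> = \<i> ^ (m mod 4)"
      unfolding power_add power_mult by simp
    finally show ?thesis .
  qed
  then have "?G = (\<Sum>x\<in>C. \<i> ^ (hamming_weight n x mod 4))"
    by (intro sum.cong) auto
  also have "\<dots> = Complex (of_int (c 0 - c 2)) (of_int (c 1 - c 3))"
    by (subst sum_by_weight_class[OF fin]) (simp add: c_def complex_eq_iff power3_eq_cube)
  finally have G: "?G = Complex (of_int (c 0 - c 2)) (of_int (c 1 - c 3))" .
  have "complex_of_real (of_int ((c 0 - c 2)\<^sup>2 + (c 1 - c 3)\<^sup>2)) = ?G * cnj ?G"
    unfolding complex_mult_cnj G by simp
  also have "\<dots> = complex_of_real (of_int (int (card C)))"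
    using gauss_sum_norm[OF C \<open>LCD n C\<close>] by simp
  finally show ?thesis
    by (simp only: of_real_eq_iff of_int_eq_iff)
qed

lemma weight_class_odd:
  fixes n :: nat
  assumes C: "F2.subspace C" "finite C"
  defines "c \<equiv> weight_class n C"
  shows "c 1 + c 3 = 0 \<or> 2 * (c 1 + c 3) = card C"
proof -
  let ?f = "\<lambda>x. of_bool (odd (hamming_weight n x)) :: bit"
  have "even (hamming_weight n (x + y)) = (even (hamming_weight n x) = even (hamming_weight n y))" for x y
    using arg_cong[OF hamming_weight_add[of n x y], of even] by simp
  then have "card {x\<in>C. ?f x = 1} = 0 \<or> 2 * card {x\<in>C. ?f x = 1} = card C"
    by (intro card_fibre_additive[OF C]) auto
  moreover have "card {x\<in>C. ?f x = 1} = (\<Sum>x\<in>C. of_bool (odd (hamming_weight n x mod 4)))"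
    by (simp add: C(2) Int_def dvd_mod_iff)
  then have "card {x\<in>C. ?f x = 1} = c 1 + c 3"
    by (subst (asm) sum_by_weight_class[OF C(2)]) (simp add: c_def)
  ultimately show ?thesis by simp
qed

text \<open>The Gauss sum is a Gaussian integer of norm 16, and since 16 is the sum of two squares only as
\<open>16 + 0\<close>, it is one of \<open>4\<close>, \<open>-4\<close>, \<open>4\<i>\<close>, \<open>-4\<i>\<close>. The number of words of odd weight,
0 or 8, then determines the four class sizes; it is 0 only for a real Gauss sum.\<close>
lemma weight_distribution_LCD_dim_4:
  assumes C: "F2.subspace C" "C \<subseteq> F2_space n" and "LCD n C" and "card C = 16"
  defines "c \<equiv> weight_class n C"
  shows "(c 0, c 1, c 2, c 3) \<in>
    {(10,0,6,0), (6,0,10,0), (6,4,2,4), (2,4,6,4), (4,6,4,2), (4,2,4,6)}"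
proof -
  have fin: "finite C"
    using C(2) finite_F2_space finite_subset by blast
  have total: "c 0 + c 1 + c 2 + c 3 = 16"
    using sum_by_weight_class[OF fin, of "\<lambda>_. 1 :: nat" n] \<open>card C = 16\<close> by (simp add: c_def)
  have odd: "c 1 + c 3 = 0 \<or> c 1 + c 3 = 8"
    using weight_class_odd[OF C(1) fin, of n] \<open>card C = 16\<close> by (auto simp: c_def)
  \<comment> \<open>The real and imaginary parts of the Gauss sum.\<close>
  define a where "a = int (c 0) - int (c 2)"
  define b where "b = int (c 1) - int (c 3)"
  have norm: "a\<^sup>2 + b\<^sup>2 = 16"
    using weight_class_LCD[OF C \<open>LCD n C\<close>] \<open>card C = 16\<close> by (simp add: a_def b_def c_def)
  have "even a"
    using total odd unfolding a_def b_def by presburger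
  moreover have "\<bar>a\<bar> \<le> 4"
    unfolding abs_le_square_iff[of a 4, simplified] using norm zero_le_power2[of b] by linarith
  moreover have "\<bar>b\<bar> \<le> 4"
    unfolding abs_le_square_iff[of b 4, simplified] using norm zero_le_power2[of a] by linarith
  ultimately have range: "a = - 4 \<or> a = - 2 \<or> a = 0 \<or> a = 2 \<or> a = 4"
    "b = - 4 \<or> b = - 3 \<or> b = - 2 \<or> b = - 1 \<or> b = 0 \<or> b = 1 \<or> b = 2 \<or> b = 3 \<or> b = 4"
    by presburger+
  have ab: "a = 4 \<and> b = 0 \<or> a = - 4 \<and> b = 0 \<or> a = 0 \<and> b = 4 \<or> a = 0 \<and> b = - 4"
    using range norm by (elim disjE) simp_all
  define s where "s = int (c 1) + int (c 3)"
  have s: "s = 0 \<and> b = 0 \<or> s = 8"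
    using odd unfolding s_def b_def by auto
  have "c 0 = nat ((16 - s + a) div 2)" "c 1 = nat ((s + b) div 2)"
    "c 2 = nat ((16 - s - a) div 2)" "c 3 = nat ((s - b) div 2)"
    using total unfolding s_def a_def b_def by linarith+
  then show ?thesis
    using s ab by (elim disjE conjE) simp_all
qed

text \<open>The least possible value, over the six weight distributions above, of the sum of
\<open>(wt x - d) mod 4\<close> over the nonzero codewords \<open>x\<close>.\<close>
definition mod_4_excess :: "nat \<Rightarrow> nat"
  where "mod_4_excess d =
    (if d mod 4 = 0 then 12 else if d mod 4 = 1 then 17 else if d mod 4 = 2 then 10 else 19)"

text \<open>A sharpening of the Plotkin bound \<open>15 * d \<le> 8 * n\<close>. A nonzero word \<open>x\<close> has weight at
least \<open>d\<close>, hence at least \<open>d + (wt x - d) mod 4\<close>; the distribution of the weights modulo 4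
shows how much is gained in total.\<close>
lemma LCD_dim_4_bound:
  assumes "binary_code n 4 d C" "LCD n C"
  shows "15 * d + mod_4_excess d \<le> 8 * n"
proof -
  have C: "F2.subspace C" "C \<subseteq> F2_space n" and dim: "F2.dim C = 4"
    and min: "\<And>x. x \<in> C \<Longrightarrow> x \<noteq> 0 \<Longrightarrow> d \<le> hamming_weight n x"
    using assms(1) by (auto simp: binary_code_def has_min_weight_def)
  have fin: "finite C"
    using C(2) finite_F2_space finite_subset by blast
  have card: "card C = 16"
    using card_subspace_F2[OF C(1) fin] dim by simp
  have zero: "0 \<in> C"
    using C(1) F2.subspace_0 by blast
  \<comment> \<open>\<open>g j\<close> is \<open>(j - d) mod 4\<close>, without a truncated subtraction.\<close>
  define g where "g j = (j + 3 * d) mod 4" for j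
  have step: "d + g (w mod 4) \<le> w" if "d \<le> w" for w
  proof -
    have "g (w mod 4) = (w + 3 * d) mod 4"
      by (simp add: g_def mod_add_left_eq)
    also have "w + 3 * d = (w - d) + d * 4"
      using that by simp
    also have "\<dots> mod 4 = (w - d) mod 4"
      by (rule mod_mult_self1)
    finally show ?thesis
      using that mod_less_eq_dividend[of "w - d" 4] by linarith
  qed
  \<comment> \<open>The zero word contributes \<open>g 0\<close> to the sum over the code but nothing to the weights.\<close>
  have "15 * d + (\<Sum>x\<in>C. g (hamming_weight n x mod 4)) = g 0 + (\<Sum>x\<in>C - {0}. d + g (hamming_weight n x mod 4))"
    using fin zero card by (simp add: sum.remove[of C 0] sum.distrib hamming_weight_def)
  also have "\<dots> \<le> g 0 + (\<Sum>x\<in>C - {0}. hamming_weight n x)"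
    using min by (intro add_left_mono sum_mono step) auto
  also have "\<dots> = g 0 + (\<Sum>x\<in>C. hamming_weight n x)"
    using fin zero by (simp add: sum.remove[of C 0] hamming_weight_def)
  also have "\<dots> \<le> g 0 + 8 * n"
    using sum_hamming_weight_le[OF C(1) fin, of n] card by simp
  finally have main: "15 * d + (\<Sum>x\<in>C. g (hamming_weight n x mod 4)) \<le> g 0 + 8 * n" .
  define m where "m = d mod 4"
  have m: "m = 0 \<or> m = 1 \<or> m = 2 \<or> m = 3"
    unfolding m_def by presburger
  have g: "g j = (j + 3 * m) mod 4" for j
    unfolding g_def m_def by (metis mod_add_right_eq mod_mult_right_eq)
  define c where "c = weight_class n C"
  have c: "(c 0, c 1, c 2, c 3) \<in>
      {(10,0,6,0), (6,0,10,0), (6,4,2,4), (2,4,6,4), (4,6,4,2), (4,2,4,6)}"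
    unfolding c_def by (rule weight_distribution_LCD_dim_4[OF C assms(2) card])
  have "15 * d + (c 0 * g 0 + c 1 * g 1 + c 2 * g 2 + c 3 * g 3) \<le> g 0 + 8 * n"
    using main unfolding sum_by_weight_class[OF fin] c_def by simp
  then show ?thesis
    using m c unfolding mod_4_excess_def m_def[symmetric] g insert_iff empty_iff prod.inject
    by (elim disjE conjE) simp_all
qed

section \<open>LCD codes from lists of generator matrix columns\<close>

type_synonym vec4 = "bit \<times> bit \<times> bit \<times> bit"

fun dot4 :: "vec4 \<Rightarrow> vec4 \<Rightarrow> bit"
  where "dot4 (a1, a2, a3, a4) (c1, c2, c3, c4) = a1 * c1 + a2 * c2 + a3 * c3 + a4 * c4"

definition encode :: "vec4 list \<Rightarrow> vec4 \<Rightarrow> nat \<Rightarrow> bit"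
  where "encode cs a i = (if i < length cs then dot4 a (cs ! i) else 0)"

definition weight4 :: "vec4 list \<Rightarrow> vec4 \<Rightarrow> nat"
  where "weight4 cs a = (\<Sum>c\<leftarrow>cs. if dot4 a c = 1 then 1 else 0)"

definition gram4 :: "vec4 list \<Rightarrow> vec4 \<Rightarrow> vec4 \<Rightarrow> bit"
  where "gram4 cs a b = (\<Sum>c\<leftarrow>cs. dot4 a c * dot4 b c)"

text \<open>A list of columns is good for \<open>d\<close> when the code that it generates has minimum weight at least
\<open>d\<close> and the Gram matrix of its rows is nonsingular, which is the LCD property.\<close>
definition LCD_columns :: "vec4 list \<Rightarrow> nat \<Rightarrow> bool"
  where "LCD_columns cs d \<longleftrightarrow> (\<forall>a. a \<noteq> 0 \<longrightarrow> d \<le> weight4 cs a \<and> (\<exists>b. gram4 cs a b = 1))"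

lemma UNIV_bit: "UNIV = {0, 1 :: bit}"
  using bit_not_zero_iff by blast

lemma UNIV_vec4: "(UNIV :: vec4 set) = {0, 1} \<times> {0, 1} \<times> {0, 1} \<times> {0, 1}"
  by (simp flip: UNIV_bit)

lemma all_bit_iff: "(\<forall>x :: bit. P x) \<longleftrightarrow> P 0 \<and> P 1"
  by (metis bit_not_zero_iff)

lemma ex_bit_iff: "(\<exists>x :: bit. P x) \<longleftrightarrow> P 0 \<or> P 1"
  by (metis bit_not_zero_iff)

definition simplex_columns :: "vec4 list"
  where "simplex_columns = [
    (0,0,0,1), (0,0,1,0), (0,0,1,1), (0,1,0,0), (0,1,0,1), (0,1,1,0), (0,1,1,1), (1,0,0,0),
    (1,0,0,1), (1,0,1,0), (1,0,1,1), (1,1,0,0), (1,1,0,1), (1,1,1,0), (1,1,1,1)]"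

lemma weight4_simplex: "a \<noteq> 0 \<Longrightarrow> weight4 simplex_columns a = 8"
proof -
  have "\<forall>a. a \<noteq> 0 \<longrightarrow> weight4 simplex_columns a = 8"
    by (simp add: weight4_def simplex_columns_def all_bit_iff zero_prod_def)
  then show "a \<noteq> 0 \<Longrightarrow> weight4 simplex_columns a = 8" by blast
qed

lemma gram4_simplex: "gram4 simplex_columns a b = 0"
proof -
  have "\<forall>a b. gram4 simplex_columns a b = 0"
    by (simp add: gram4_def simplex_columns_def all_bit_iff)
  then show ?thesis by blast
qed

text \<open>The columns of the [15,4,8] simplex code raise every nonzero weight by exactly 8 and leave the
Gram matrix unchanged, because that code is self-orthogonal.\<close>
lemma LCD_columns_append_simplex:
  assumes "LCD_columns cs d"
  shows "LCD_columns (simplex_columns @ cs) (8 + d)"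
proof -
  have "weight4 (simplex_columns @ cs) a = 8 + weight4 cs a" if "a \<noteq> 0" for a
    using weight4_simplex[OF that] by (simp add: weight4_def)
  moreover have "gram4 (simplex_columns @ cs) a b = gram4 cs a b" for a b
    using gram4_simplex[of a b] by (simp add: gram4_def)
  ultimately show ?thesis
    using assms by (simp add: LCD_columns_def)
qed

lemma LCD_columns_append_simplex_power:
  assumes "LCD_columns cs d"
  shows "LCD_columns (concat (replicate q simplex_columns) @ cs) (8 * q + d)"
proof (induction q)
  case (Suc q)
  then show ?case
    using LCD_columns_append_simplex by (simp add: add.assoc)
qed (use assms in simp)

text \<open>One sequence serves all lengths: its prefixes of lengths 4, 5, 8, 9, 12, 13, 16 and 17
generate LCD codes of minimum weight at least 1, 2, ..., 8. It was found by a backtracking search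
starting with the unit vectors and using every nonzero vector at most once afterwards.\<close>
definition chain_columns :: "vec4 list"
  where "chain_columns = [
    (1,0,0,0), (0,1,0,0), (0,0,1,0), (0,0,0,1), (1,1,1,1), (1,1,0,0), (1,0,1,0), (0,1,0,1),
    (0,0,1,1), (1,0,0,0), (1,1,1,0), (0,0,0,1), (0,1,1,1), (0,1,0,0), (0,0,1,0), (1,1,0,1), (1,0,1,1)]"

lemma LCD_columns_chain:
  assumes "1 \<le> d" "d \<le> 8"
  shows "LCD_columns (take (2 * d + 1 + d mod 2) chain_columns) d"
proof -
  have "d = 1 \<or> d = 2 \<or> d = 3 \<or> d = 4 \<or> d = 5 \<or> d = 6 \<or> d = 7 \<or> d = 8"
    using assms by presburger
  then show ?thesis
    by (elim disjE; hypsubst)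
       (simp add: LCD_columns_def weight4_def gram4_def chain_columns_def all_bit_iff ex_bit_iff zero_prod_def)+
qed

lemma encode_add: "encode cs (a + b) = encode cs a + encode cs b"
proof -
  have "dot4 (a + b) c = dot4 a c + dot4 b c" for c
    by (cases a; cases b; cases c) (simp add: algebra_simps)
  then show ?thesis
    by (auto simp: encode_def fun_eq_iff)
qed

lemma hamming_weight_encode:
  assumes "length cs \<le> n"
  shows "hamming_weight n (encode cs a) = weight4 cs a"
proof -
  have "hamming_weight n (encode cs a) = (\<Sum>i<n. if encode cs a i = 1 then 1 else 0)"
    by (rule hamming_weight_eq_sum)
  also have "\<dots> = (\<Sum>i<length cs. if encode cs a i = 1 then 1 else 0)"
    using assms by (intro sum.mono_neutral_right) (auto simp: encode_def)
  also have "\<dots> = (\<Sum>i<length cs. if dot4 a (cs ! i) = 1 then 1 else 0)"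
    by (simp add: encode_def)
  finally show ?thesis
    by (simp add: weight4_def sum_list_sum_nth atLeast0LessThan)
qed

lemma inner_F2_encode:
  assumes "length cs \<le> n"
  shows "inner_F2 n (encode cs a) (encode cs b) = gram4 cs a b"
proof -
  have "inner_F2 n (encode cs a) (encode cs b) = (\<Sum>i<length cs. encode cs a i * encode cs b i)"
    unfolding inner_F2_def using assms by (intro sum.mono_neutral_right) (auto simp: encode_def)
  then show ?thesis
    by (simp add: gram4_def encode_def sum_list_sum_nth atLeast0LessThan)
qed

text \<open>The length \<open>n\<close> may exceed the number of columns: further coordinates are zero and affect
neither weights nor inner products.\<close>
lemma LCD_code_of_columns:
  assumes cs: "LCD_columns cs d" and "1 \<le> d" and len: "length cs \<le> n"
  shows "\<exists>d' C. d \<le> d' \<and> binary_code n 4 d' C \<and> LCD n C"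
proof -
  let ?C = "range (encode cs)"
  have enc0: "encode cs 0 = 0"
    using encode_add[of cs 0 0] by simp
  have weight: "d \<le> hamming_weight n (encode cs a)" if "a \<noteq> 0" for a
    using cs that unfolding LCD_columns_def hamming_weight_encode[OF len] by blast
  have nonzero: "encode cs a \<noteq> 0" if "a \<noteq> 0" for a
    using weight[OF that] \<open>1 \<le> d\<close> by (auto simp: hamming_weight_def)
  have sub: "F2.subspace ?C"
    unfolding subspace_F2_iff using enc0 by (auto simp flip: encode_add intro: range_eqI[of _ _ 0])
  have "inj (encode cs)"
  proof (rule injI)
    fix a b assume "encode cs a = encode cs b"
    then have "encode cs (a + b) = 0"
      by (simp add: encode_add)
    then have "a + b = 0"
      using nonzero by blast
    moreover have "a + b + b = a"
      by (cases a; cases b) (simp add: add.assoc)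
    ultimately show "a = b"
      by simp
  qed
  moreover have "card (UNIV :: vec4 set) = 16" "finite (UNIV :: vec4 set)"
    unfolding UNIV_vec4 by (simp_all add: card_cartesian_product)
  ultimately have card: "card ?C = 16" and fin: "finite ?C"
    by (simp_all add: card_image)
  have "2 ^ F2.dim ?C = (2 :: nat) ^ 4"
    using card_subspace_F2[OF sub fin] card by simp
  then have dim: "F2.dim ?C = 4"
    by (subst (asm) power_inject_exp) auto
  have "?C - {0} \<noteq> {}"
    using nonzero[of "(1, 0, 0, 0)"] by (auto simp: zero_prod_def)
  define d' where "d' = Min (hamming_weight n ` (?C - {0}))"
  have "d' \<in> hamming_weight n ` (?C - {0})"
    unfolding d'_def using fin \<open>?C - {0} \<noteq> {}\<close> by (intro Min_in) auto
  moreover have "\<forall>x\<in>?C - {0}. d' \<le> hamming_weight n x"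
    unfolding d'_def using fin by (intro ballI Min_le) auto
  ultimately have "has_min_weight n ?C d'"
    unfolding has_min_weight_def by auto
  moreover have "?C \<subseteq> F2_space n"
    using len by (auto simp: F2_space_def encode_def)
  ultimately have "binary_code n 4 d' ?C"
    using sub dim by (simp add: binary_code_def)
  moreover have "d \<le> d'"
  proof -
    obtain a where "d' = hamming_weight n (encode cs a)" "encode cs a \<noteq> 0"
      using \<open>d' \<in> _\<close> by blast
    then show ?thesis
      using weight[of a] enc0 by metis
  qed
  moreover have "LCD n ?C"
  proof -
    have "encode cs a = 0" if "encode cs a \<in> dual_code n ?C" for a
    proof (rule ccontr)
      assume "encode cs a \<noteq> 0"
      then have "a \<noteq> 0"
        using enc0 by metis
      then obtain b where "gram4 cs a b = 1"
        using cs unfolding LCD_columns_def by blast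
      moreover have "inner_F2 n (encode cs a) (encode cs b) = 0"
        using that unfolding dual_code_def by blast
      ultimately show False
        by (simp add: inner_F2_encode[OF len])
    qed
    moreover have "0 \<in> ?C" "0 \<in> dual_code n ?C"
      using enc0 by (auto simp: dual_code_def F2_space_def inner_F2_def intro: range_eqI[of _ _ 0])
    ultimately show ?thesis
      unfolding LCD_def by blast
  qed
  ultimately show ?thesis by blast
qed

lemma LCD_dim_4_exists:
  assumes "1 \<le> d" "d \<le> 8" "15 * q + (2 * d + 1 + d mod 2) \<le> n"
  shows "\<exists>d' C. 8 * q + d \<le> d' \<and> binary_code n 4 d' C \<and> LCD n C"
proof (rule LCD_code_of_columns)
  let ?base = "take (2 * d + 1 + d mod 2) chain_columns"
  show "LCD_columns (concat (replicate q simplex_columns) @ ?base) (8 * q + d)"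
    by (intro LCD_columns_append_simplex_power LCD_columns_chain assms)
  have "length (concat (replicate q simplex_columns)) = 15 * q"
    by (induction q) (auto simp: simplex_columns_def)
  then show "length (concat (replicate q simplex_columns) @ ?base) \<le> n"
    using assms(3) by simp
qed (use assms in auto)

section \<open>The largest minimum weight\<close>

lemma d2_dim_4_eqI:
  assumes upper: "\<And>d. 15 * d + mod_4_excess d \<le> 8 * n \<Longrightarrow> d \<le> 8 * q + e"
    and e: "1 \<le> e" "e \<le> 8" "15 * q + (2 * e + 1 + e mod 2) \<le> n"
  shows "d2 n 4 = 8 * q + e"
proof -
  let ?S = "{d. \<exists>C. binary_code n 4 d C \<and> LCD n C}"
  have le: "d \<le> 8 * q + e" if "d \<in> ?S" for d
    using that LCD_dim_4_bound upper by blast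
  obtain d' C where "8 * q + e \<le> d'" "binary_code n 4 d' C" "LCD n C"
    using LCD_dim_4_exists[OF e] by blast
  then have "8 * q + e \<in> ?S"
    using le[of d'] by (auto intro: antisym)
  moreover have "finite ?S"
    using le by (intro finite_subset[of ?S "{..8 * q + e}"]) auto
  ultimately show ?thesis
    unfolding d2_def using le by (intro Max_eqI) auto
qed

theorem proposition6p5:
  fixes n :: nat
  assumes "n \<ge> 4"
  shows "int (d2 n 4) =
    (if n mod 15 \<in> {5, 9, 13} then \<lfloor>8 * real n / 15\<rfloor>
     else if n mod 15 \<in> {1, 2, 3, 4, 6, 7, 8, 10, 11, 12, 14} then \<lfloor>8 * real n / 15\<rfloor> - 1
     else \<lfloor>8 * real n / 15\<rfloor> - 2)"
proof -
  \<comment> \<open>The remainder is taken in \<open>{4..18}\<close>, so that a prefix of the chain always fits into \<open>r\<close> columns.\<close>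
  define q where "q = (n - 4) div 15"
  define r where "r = (n - 4) mod 15 + 4"
  have n: "n = 15 * q + r"
    unfolding q_def r_def using assms by simp
  have "4 \<le> r" "r \<le> 18"
    unfolding r_def using mod_less_divisor[of 15 "n - 4"] by simp_all
  then have r: "r = 4 \<or> r = 5 \<or> r = 6 \<or> r = 7 \<or> r = 8 \<or> r = 9 \<or> r = 10 \<or> r = 11 \<or>
      r = 12 \<or> r = 13 \<or> r = 14 \<or> r = 15 \<or> r = 16 \<or> r = 17 \<or> r = 18"
    by presburger
  have "\<lfloor>8 * real n / 15\<rfloor> = int (8 * n div 15)"
    using floor_divide_of_nat_eq[of "8 * n" 15, where 'a = real] by simp
  also have "8 * n div 15 = 8 * q + 8 * r div 15"
    using div_mult_self1[of 15 "8 * r" "8 * q"] by (simp add: n algebra_simps)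
  finally have floor: "\<lfloor>8 * real n / 15\<rfloor> = int (8 * q + 8 * r div 15)" .
  have mod: "n mod 15 = r mod 15"
    by (simp add: n)
  \<comment> \<open>The longest usable prefix of at most \<open>r\<close> columns has minimum weight \<open>e\<close>, which takes the values 1, 2, 2, 2, 3, 4, 4, 4, 5, 6, 6, 6, 7, 8, 8.\<close>
  define e where "e = r div 2 - of_bool (r mod 4 \<noteq> 1)"
  have "d2 n 4 = 8 * q + e"
  proof (rule d2_dim_4_eqI)
    fix d assume bound: "15 * d + mod_4_excess d \<le> 8 * n"
    obtain k m where d: "d = 4 * k + m"
      and m: "m = 0 \<and> mod_4_excess d = 12 \<or> m = 1 \<and> mod_4_excess d = 17 \<or>
        m = 2 \<and> mod_4_excess d = 10 \<or> m = 3 \<and> mod_4_excess d = 19"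
    proof
      show "d = 4 * (d div 4) + d mod 4" by simp
      have "d mod 4 < 4" by simp
      then show "d mod 4 = 0 \<and> mod_4_excess d = 12 \<or> d mod 4 = 1 \<and> mod_4_excess d = 17 \<or>
        d mod 4 = 2 \<and> mod_4_excess d = 10 \<or> d mod 4 = 3 \<and> mod_4_excess d = 19"
        unfolding mod_4_excess_def by auto
    qed
    have "60 * k + 15 * m + mod_4_excess d \<le> 120 * q + 8 * r"
      using bound by (simp add: n d)
    then have "4 * k + m \<le> 8 * q + e"
      using m r unfolding e_def by (elim disjE conjE; hypsubst) (simp; presburger)+
    then show "d \<le> 8 * q + e"
      by (simp add: d)
  qed (use r n in \<open>auto simp: e_def\<close>)
  then show ?thesis
    unfolding floor mod using r by (elim disjE) (simp_all add: e_def)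
qed

end
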